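(* Let $P=(T_0,\dots,T_{m-1})$ be a finite pseudocycle of cycle length $m$ with directed cycle $Z=(z_0,\dots,z_{m-1})$, and let $P'=(T'_0,\dots,T'_{l-1})$ be a finite pseudocycle of cycle length $l$ with directed cycle $(z'_0,\dots,z'_{l-1})$, where $l\mid m$. Let a graph homomorphism $g:P\to P'$ be defined by the triple $[g(z_0),[\mathcal{A}],[\Phi]]$, where $[\mathcal{A}]=[\mathcal{A}_0,\dots,\mathcal{A}_{m-1}]$ is the sequence of incomparable vertex subsets of $g$ and $[\Phi]$ is the corresponding sequence of tree homomorphisms (both described in the context). Then: (1) $\mathrm{Hom}(P,P')=\bigsqcup_{k=0}^{l-1}\mathrm{Hom}(z_0,z'_k)$, where $\mathrm{Hom}(z_0,z'_k)$ is the set of graph homomorphisms $P\to P'$ sending $z_0$ to $z'_k$; (2) $\mathrm{Hom}(z_0,z'_k)=\bigsqcup_{[\mathcal{A}]\in\mathrm{Inc}(P)}\mathrm{Hom}(z_0,z'_k,[\mathcal{A}])$, where $\mathrm{Hom}(z_0,z'_k,[\mathcal{A}])$ is the set of graph homomorphisms $P\to P'$ sending $z_0$ to $z'_k$ with the sequence of incomparable vertex subsets $[\mathcal{A}]$, the disjoint union being taken over all possible sequences of incomparable vertex subsets $[\mathcal{A}]\in\mathrm{Inc}(P)$; (3) $$\mathrm{Hom}(z_0,z'_k,[\mathcal{A}])=\prod_{i=0}^{m-1}\ \prod_{h\ge1}\ \prod_{x\in\mathcal{A}_i(h)}\mathrm{Hom}\big(\mathcal{T}(x),\widetilde{T}'_{\,i+k-h+1\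 (\mathrm{mod}\ l)}\big)$$ (Cartesian product of sets); (4) $$|\mathrm{Hom}(P,P')|=\sum_{k=0}^{l-1}|\mathrm{Hom}(z_0,z'_k)|=\sum_{k=0}^{l-1}\sum_{[\mathcal{A}]\in\mathrm{Inc}(P)}|\mathrm{Hom}(z_0,z'_k,[\mathcal{A}])|=\sum_{k=0}^{l-1}\ \sum_{[\mathcal{A}]\in\mathrm{Inc}(P)}\ \prod_{i=0}^{m-1}\ \prod_{h\ge1}\ \prod_{x\in\mathcal{A}_i(h)}\big|\mathrm{Hom}\big(\mathcal{T}(x),\widetilde{T}'_{\,i+k-h+1\ (\mathrm{mod}\ l)}\big)\big|.$$
   Context: A pseudocycle is a weakly connected functional graph (every vertex has exactly one outgoing edge) which contains exactly one directed cycle (possibly a loop); its cycle length is the length of that cycle. It is written $P=(T_0,\dots,T_{m-1})$ with directed cycle $(z_0,\dots,z_{m-1})$ (edges $z_i\to z_{i+1}$, indices mod $m$), where $T_i$ is the directed tree with root $z_i$ consisting of $z_i$ and all vertices whose forward path meets the cycle first at $z_i$. The height $\phi$ of a vertex is the length of its directed path to the nearest cycle vertex. For a vertex $x$ not on the cycle, $\mathcal{T}(x)$ is the directed tree with root $x$ consisting of all vertices having a directed path to $x$. Tree order: $x\le y$ if there is a directed path from $y$ to $x$ in the tree. For a directed tree $T$ with root $z$, $\mathrm{Inc}(T)$ is the set of incomparable vertex subsets of $T$, i.e. subsets $A$ of the vertex set of $T$ minus $z$ containing no two distinct $x,y$ with $x<y$ (the empty set included); $\mathrm{Inc}(P)=\mathrm{Inc}(T_0)\times\dots\times\mathrm{Inc}(T_{m-1})$.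 For a homomorphism $g:P\to P'$, its sequence of incomparable vertex subsets is $[\mathcal{A}_0,\dots,\mathcal{A}_{m-1}]$ with $\mathcal{A}_i$ the set of vertices $x$ of $T_i$ other than $z_i$ with $\phi(g(x))=1$, and $[\Phi]=[\Phi_0,\dots,\Phi_{m-1}]$ with $\Phi_i=[\varphi_x]_{x\in\mathcal{A}_i}$, $\varphi_x\in\mathrm{Hom}(\mathcal{T}(x),\mathcal{T}(g(x)))$. $\mathcal{A}_i(h)$ is the set of elements of $\mathcal{A}_i$ at distance $h$ from the root $z_i$ of $T_i$. $\widetilde{T}'_j$ is the root-truncated graph $T'_j\setminus\{z'_j\}$. $\mathrm{Hom}(\Gamma,\Delta)$ is the set of directed graph homomorphisms $\Gamma\to\Delta$. Empty products equal $1$ (an empty Cartesian product is a one-element set). In (3) a homomorphism is identified with the family of its restrictions to the subtrees $\mathcal{T}(x)$.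
   Formalization: In (3) and (4), Hom(T(x), T̃'_j) is taken to be the homomorphisms sending the root x to a root of the truncated forest (a vertex of height 1); with arbitrary digraph homomorphisms the formulas fail, e.g. for P = loop z with x→z and P' = loop z' with b→a→z' (2 versus 3). *)

theory Defs
  imports "Graph_Theory.Graph_Theory" "HOL-Library.FuncSet" "HOL-Library.Disjoint_Sets"
begin

section \<open>Homomorphisms\<close>

text \<open>
  Homomorphisms are vertex maps, made extensional so that they can be counted. All digraphs
  to which this is applied have out-degree at most one, hence no parallel arcs, so that nothing
  is lost by not recording the action on arcs.
\<close>

definition digraph_Hom :: "('a,'b) pre_digraph \<Rightarrow> ('c,'d) pre_digraph \<Rightarrow> ('a \<Rightarrow> 'c) set" where
  "digraph_Hom G H =
     {f \<in> verts G \<rightarrow>\<^sub>E verts H. \<forall>u v. u \<rightarrow>\<^bsub>G\<^esub> v \<longrightarrow> f u \<rightarrow>\<^bsub>H\<^esub> f v}"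

text \<open>Arcs of a directed tree point towards its root, so the roots of a forest are its sinks.\<close>

definition forest_roots :: "('a,'b) pre_digraph \<Rightarrow> 'a set" where
  "forest_roots F = {v \<in> verts F. out_arcs F v = {}}"

text \<open>
  Homomorphisms of rooted trees and forests send roots to roots. This is what is meant by
  \<open>Hom(\<T>(x), \<T>(g(x)))\<close> and by \<open>Hom(\<T>(x), T'\<^sub>j \ {z'\<^sub>j})\<close>: \<open>\<phi>\<^sub>x\<close> is the restriction of \<open>g\<close> to
  \<open>\<T>(x)\<close>, and it sends \<open>x\<close> to the root \<open>g(x)\<close> of \<open>\<T>(g(x))\<close>. With arbitrary digraph homomorphisms
  the product formula would be false: if \<open>P\<close> is a loop \<open>z\<close> with one more arc \<open>x \<rightarrow> z\<close>, and \<open>P'\<close> is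
  a loop \<open>z'\<close> with the path \<open>b \<rightarrow> a \<rightarrow> z'\<close> attached, there are two homomorphisms from \<open>P\<close>
  to \<open>P'\<close>, and \<open>x \<mapsto> b\<close> is a digraph homomorphism from \<open>\<T>(x)\<close> that comes from neither of them.
\<close>

definition forest_Hom :: "('a,'b) pre_digraph \<Rightarrow> ('c,'d) pre_digraph \<Rightarrow> ('a \<Rightarrow> 'c) set" where
  "forest_Hom F F' = {f \<in> digraph_Hom F F'. f ` forest_roots F \<subseteq> forest_roots F'}"


section \<open>Pseudocycles\<close>

definition functional_graph :: "('a,'b) pre_digraph \<Rightarrow> bool" where
  "functional_graph P \<longleftrightarrow> wf_digraph P \<and> (\<forall>v \<in> verts P. out_degree P v = 1)"

text \<open>
  The library's \<open>cycle\<close> allows loops and is a list of arcs with a starting point; taking the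
  set of its arcs identifies the rotations of one and the same directed cycle. The library's
  \<open>connected\<close> is weak connectedness.
\<close>

definition pseudocycle :: "('a,'b) pre_digraph \<Rightarrow> bool" where
  "pseudocycle P \<longleftrightarrow> functional_graph P \<and> Digraph_Component.connected P \<and>
     (\<exists>!C. \<exists>p. pre_digraph.cycle P p \<and> C = set p)"

text \<open>\<open>(z 0, \<dots>, z (m - 1))\<close> is a directed cycle of \<open>P\<close>, listed along its arcs.\<close>

definition directed_cycle :: "('a,'b) pre_digraph \<Rightarrow> nat \<Rightarrow> (nat \<Rightarrow> 'a) \<Rightarrow> bool" where
  "directed_cycle P m z \<longleftrightarrow> (\<exists>p. pre_digraph.cycle P p \<and> map (tail P) p = map z [0..<m])"

definition cycle_verts :: "('a,'b) pre_digraph \<Rightarrow> 'a set" where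
  "cycle_verts P = {v. \<exists>p. pre_digraph.cycle P p \<and> v \<in> tail P ` set p}"

definition height :: "('a,'b) pre_digraph \<Rightarrow> 'a \<Rightarrow> nat" where
  "height P v = (LEAST n. \<exists>c \<in> cycle_verts P. (v, c) \<in> arcs_ends P ^^ n)"

text \<open>
  The tree \<open>T\<^sub>i\<close> with root \<open>c = z\<^sub>i\<close>. The walk of length \<open>height P v\<close> from \<open>v\<close> ends at the first
  cycle vertex on the forward path of \<open>v\<close>. The arc leaving \<open>c\<close> is not part of the tree; this
  matters when the cycle is a loop.
\<close>

definition cycle_tree :: "('a,'b) pre_digraph \<Rightarrow> 'a \<Rightarrow> ('a,'b) pre_digraph" where
  "cycle_tree P c =
     (let G = P \<restriction> {v \<in> verts P. (v, c) \<in> arcs_ends P ^^ height P v}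
      in G\<lparr>arcs := arcs G - out_arcs G c\<rparr>)"

text \<open>\<open>\<T>(x)\<close>, for a vertex \<open>x\<close> off the cycle.\<close>

definition subtree :: "('a,'b) pre_digraph \<Rightarrow> 'a \<Rightarrow> ('a,'b) pre_digraph" where
  "subtree P x = P \<restriction> {y \<in> verts P. y \<rightarrow>\<^sup>*\<^bsub>P\<^esub> x}"


section \<open>Incomparable vertex subsets\<close>

definition tree_le :: "('a,'b) pre_digraph \<Rightarrow> 'a \<Rightarrow> 'a \<Rightarrow> bool" where
  "tree_le T x y \<longleftrightarrow> y \<rightarrow>\<^sup>*\<^bsub>T\<^esub> x"

definition tree_less :: "('a,'b) pre_digraph \<Rightarrow> 'a \<Rightarrow> 'a \<Rightarrow> bool" where
  "tree_less T x y \<longleftrightarrow> tree_le T x y \<and> x \<noteq> y"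

text \<open>\<open>Inc T r\<close> is \<open>Inc(T)\<close> for the tree \<open>T\<close> with root \<open>r\<close>.\<close>

definition Inc :: "('a,'b) pre_digraph \<Rightarrow> 'a \<Rightarrow> 'a set set" where
  "Inc T r = {A. A \<subseteq> verts T - {r} \<and> (\<forall>x \<in> A. \<forall>y \<in> A. x \<noteq> y \<longrightarrow> \<not> tree_less T x y)}"

definition Inc_seqs :: "('a,'b) pre_digraph \<Rightarrow> nat \<Rightarrow> (nat \<Rightarrow> 'a) \<Rightarrow> (nat \<Rightarrow> 'a set) set" where
  "Inc_seqs P m z = (\<Pi>\<^sub>E i \<in> {..<m}. Inc (cycle_tree P (z i)) (z i))"

definition inc_seq ::
  "('a,'b) pre_digraph \<Rightarrow> nat \<Rightarrow> (nat \<Rightarrow> 'a) \<Rightarrow> ('c,'d) pre_digraph \<Rightarrow> ('a \<Rightarrow> 'c) \<Rightarrow> nat \<Rightarrow> 'a set" where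
  "inc_seq P m z P' g =
     (\<lambda>i \<in> {..<m}. {x \<in> verts (cycle_tree P (z i)) - {z i}. height P' (g x) = 1})"

definition tree_dist :: "('a,'b) pre_digraph \<Rightarrow> 'a \<Rightarrow> 'a \<Rightarrow> nat" where
  "tree_dist T x r = (LEAST n. (x, r) \<in> arcs_ends T ^^ n)"

text \<open>
  \<open>\<A>\<^sub>i(h)\<close>. For a finite \<open>A i\<close> only finitely many levels are nonempty. A numerical product over
  all \<open>h \<ge> 1\<close> has to be taken over those \<open>h\<close> with \<open>level P z A i h \<noteq> {}\<close>, the other factors
  being empty products: \<open>prod\<close> over an infinite index set is \<open>1\<close> by convention. The
  Cartesian product \<open>PiE\<close> can be taken over all \<open>h \<ge> 1\<close>, its empty factors being singletons.
\<close>

definition level ::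
  "('a,'b) pre_digraph \<Rightarrow> (nat \<Rightarrow> 'a) \<Rightarrow> (nat \<Rightarrow> 'a set) \<Rightarrow> nat \<Rightarrow> nat \<Rightarrow> 'a set" where
  "level P z A i h = {x \<in> A i. tree_dist (cycle_tree P (z i)) x (z i) = h}"


section \<open>The sets in the decomposition\<close>

definition Hom_at :: "('a,'b) pre_digraph \<Rightarrow> ('c,'d) pre_digraph \<Rightarrow> 'a \<Rightarrow> 'c \<Rightarrow> ('a \<Rightarrow> 'c) set" where
  "Hom_at P P' v w = {g \<in> digraph_Hom P P'. g v = w}"

definition Hom_at_inc ::
  "('a,'b) pre_digraph \<Rightarrow> nat \<Rightarrow> (nat \<Rightarrow> 'a) \<Rightarrow> ('c,'d) pre_digraph \<Rightarrow> 'c \<Rightarrow> (nat \<Rightarrow> 'a set)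
    \<Rightarrow> ('a \<Rightarrow> 'c) set" where
  "Hom_at_inc P m z P' w A = {g \<in> Hom_at P P' (z 0) w. inc_seq P m z P' g = A}"

text \<open>\<open>T'\<^sub>j \ {z'\<^sub>j}\<close> for \<open>j = i + k - h + 1 (mod l)\<close>, the residue being computed in the integers.\<close>

definition truncated_tree ::
  "('c,'d) pre_digraph \<Rightarrow> nat \<Rightarrow> (nat \<Rightarrow> 'c) \<Rightarrow> nat \<Rightarrow> nat \<Rightarrow> nat \<Rightarrow> ('c,'d) pre_digraph" where
  "truncated_tree P' l z' i k h =
     (let j = nat ((int i + int k - int h + 1) mod int l)
      in pre_digraph.del_vert (cycle_tree P' (z' j)) (z' j))"

text \<open>
  The family of restrictions of \<open>g\<close> to the trees \<open>\<T>(x)\<close>, i.e. the sequence \<open>[\<Phi>]\<close> of \<open>g\<close>, indexed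
  by \<open>i\<close>, by the distance \<open>h\<close> of \<open>x\<close> from \<open>z\<^sub>i\<close>, and by \<open>x\<close>.
\<close>

definition restriction_family ::
  "('a,'b) pre_digraph \<Rightarrow> nat \<Rightarrow> (nat \<Rightarrow> 'a) \<Rightarrow> (nat \<Rightarrow> 'a set) \<Rightarrow> ('a \<Rightarrow> 'c)
    \<Rightarrow> nat \<Rightarrow> nat \<Rightarrow> 'a \<Rightarrow> 'a \<Rightarrow> 'c" where
  "restriction_family P m z A g =
     (\<lambda>i \<in> {..<m}. \<lambda>h \<in> {1..}. \<lambda>x \<in> level P z A i h. restrict g (verts (subtree P x)))"

end

theory Submission
  imports Defs "HOL-Number_Theory.Cong"
begin

text \<open>
  A functional graph is the graph of its successor map, and a homomorphism \<open>g\<close> between two such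
  graphs is a map that commutes with the successors. Everything below is about two such maps.

  Number the cycle of \<open>P\<close> by the integers modulo \<open>m\<close>. A vertex \<open>v\<close> enters the cycle after
  \<open>height P v\<close> steps, at \<open>z\<^sub>i\<close> say; from then on it moves in step with the cycle vertex of number
  \<open>i - height P v\<close>. This number, the offset of \<open>v\<close>, grows by one with every step. Since
  \<open>l dvd m\<close>, offsets make sense modulo \<open>l\<close> as well, and a homomorphism with \<open>g z\<^sub>0 = z'\<^sub>k\<close> turns the
  offset \<open>j\<close> of \<open>v\<close> into the offset \<open>j + k\<close> of \<open>g v\<close> (\<open>Hom_offset\<close>). Two consequences: a vertex
  that \<open>g\<close> sends into the cycle has no freedom, and a vertex \<open>x\<close> of offset \<open>j\<close> whose image has
  height one is sent to a predecessor of the vertex of number \<open>j + k + 1\<close> on the cycle of \<open>P'\<close>; for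
  \<open>x\<close> at distance \<open>h\<close> from \<open>z\<^sub>i\<close> this number is \<open>i + k - h + 1\<close>, the index in the product formula.

  The vertices off the cycle whose image has height one form an antichain, because outside
  the cycle heights drop by one along each arc. Every vertex whose image has positive height lies above exactly one
  of them. So \<open>g\<close> is determined by \<open>k\<close>, the antichain, and its restrictions to the subtrees above
  the antichain (\<open>Hom_at_eqI\<close>). Conversely, arbitrary root-preserving homomorphisms on these
  subtrees fit together (\<open>ex_Hom_gluing\<close>): the remaining vertices are sent to the cycle vertex
  dictated by their offset, and the only arcs joining the two regions leave the roots
  of the subtrees, where the product formula prescribes the correct cycle vertex. These two facts
  give the bijection \<open>bij_betw_restriction_family\<close>, and the numerical formula follows by
  counting. The two disjoint unions classify homomorphisms by the image of \<open>z\<^sub>0\<close>, which is periodic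
  and hence on the cycle, and by their antichain.
\<close>


section \<open>Arcs of derived digraphs, and an infinite product of finite sets\<close>

lemma out_arcs_empty_iff: "out_arcs G v = {} \<longleftrightarrow> (\<forall>w. \<not> v \<rightarrow>\<^bsub>G\<^esub> w)"
  by (auto simp: arcs_ends_conv out_arcs_def image_iff)

lemma funpow_funpow: "(f ^^ a) ((f ^^ b) x) = (f ^^ (a + b)) x"
  by (simp add: funpow_add)

text \<open>
  The product over all distances from the root has infinitely many factors, but all except
  finitely many of them are singletons.
\<close>

lemma card_PiE_singletons:
  assumes "finite J" "J \<subseteq> I" "\<And>i. i \<in> I - J \<Longrightarrow> is_singleton (B i)"
  shows "card (\<Pi>\<^sub>E i \<in> I. B i) = (\<Prod>i \<in> J. card (B i))"
proof -
  have "bij_betw (\<lambda>f. restrict f J) (\<Pi>\<^sub>E i \<in> I. B i) (\<Pi>\<^sub>E i \<in> J. B i)"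
  proof (rule bij_betwI')
    fix f g assume f: "f \<in> (\<Pi>\<^sub>E i \<in> I. B i)" and g: "g \<in> (\<Pi>\<^sub>E i \<in> I. B i)"
    show "restrict f J = restrict g J \<longleftrightarrow> f = g"
    proof
      assume eq: "restrict f J = restrict g J"
      show "f = g"
      proof (rule PiE_ext[OF f g])
        fix i assume i: "i \<in> I"
        show "f i = g i"
        proof (cases "i \<in> J")
          case True
          then show ?thesis using eq by (metis restrict_apply')
        next
          case False
          then show ?thesis
            using assms(3)[of i] PiE_mem[OF f i] PiE_mem[OF g i] i by (auto simp: is_singleton_def)
        qed
      qed
    qed simp
  next
    fix f assume "f \<in> (\<Pi>\<^sub>E i \<in> I. B i)"
    then show "restrict f J \<in> (\<Pi>\<^sub>E i \<in> J. B i)"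
      using assms(2) by auto
  next
    fix f assume f: "f \<in> (\<Pi>\<^sub>E i \<in> J. B i)"
    define g where "g = (\<lambda>i \<in> I. if i \<in> J then f i else the_elem (B i))"
    have "the_elem (B i) \<in> B i" if "i \<in> I - J" for i
      using assms(3)[OF that] by (metis is_singleton_the_elem singletonI)
    then have "g \<in> (\<Pi>\<^sub>E i \<in> I. B i)"
      using PiE_mem[OF f] by (simp add: g_def)
    moreover have "f = restrict g J"
    proof
      fix i show "f i = restrict g J i"
        using assms(2) PiE_arb[OF f, of i] by (cases "i \<in> J") (auto simp: g_def)
    qed
    ultimately show "\<exists>g \<in> (\<Pi>\<^sub>E i \<in> I. B i). f = restrict g J" by blast
  qed
  then show ?thesis
    using assms(1) by (simp add: bij_betw_same_card card_PiE)
qed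

lemma dominates_induce_iff:
  "u \<rightarrow>\<^bsub>G \<restriction> S\<^esub> v \<longleftrightarrow> u \<rightarrow>\<^bsub>G\<^esub> v \<and> u \<in> S \<and> v \<in> S"
  by (auto simp: arcs_ends_conv)

lemma dominates_remove_out_arcs_iff:
  "u \<rightarrow>\<^bsub>G\<lparr>arcs := arcs G - out_arcs G c\<rparr>\<^esub> v \<longleftrightarrow> u \<rightarrow>\<^bsub>G\<^esub> v \<and> u \<noteq> c"
  by (auto simp: arcs_ends_conv)

lemma dominates_del_vert_iff:
  "u \<rightarrow>\<^bsub>pre_digraph.del_vert G c\<^esub> v \<longleftrightarrow> u \<rightarrow>\<^bsub>G\<^esub> v \<and> u \<noteq> c \<and> v \<noteq> c"
  by (auto simp: arcs_ends_conv pre_digraph.del_vert_simps)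


section \<open>The successor map of a pseudocycle\<close>

locale pseudocycle_graph =
  fixes G :: "('a,'b) pre_digraph" and m :: nat and z :: "nat \<Rightarrow> 'a"
  assumes pseudocycle: "pseudocycle G" and directed_cycle: "directed_cycle G m z"

sublocale pseudocycle_graph \<subseteq> wf_digraph G
  using pseudocycle by (simp add: pseudocycle_def functional_graph_def)

context pseudocycle_graph
begin

definition succ :: "'a \<Rightarrow> 'a" where
  "succ v = head G (the_elem (out_arcs G v))"

lemma dominates_iff: "u \<rightarrow>\<^bsub>G\<^esub> v \<longleftrightarrow> u \<in> verts G \<and> v = succ u"
proof (cases "u \<in> verts G")
  case True
  then have "card (out_arcs G u) = 1"
    using pseudocycle by (simp add: pseudocycle_def functional_graph_def out_degree_def)
  then obtain e where e: "out_arcs G u = {e}"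
    by (auto simp: card_1_singleton_iff)
  then have "arcs_ends G `` {u} = {head G e}"
    by (force simp: arcs_ends_conv out_arcs_def set_eq_iff)
  then show ?thesis
    using True e by (auto simp: succ_def)
next
  case False
  then show ?thesis using adj_in_verts by blast
qed

lemma succ_in_verts [simp]: "v \<in> verts G \<Longrightarrow> succ v \<in> verts G"
  using dominates_iff adj_in_verts(2) by blast

lemma funpow_succ_in_verts [simp]: "v \<in> verts G \<Longrightarrow> (succ ^^ n) v \<in> verts G"
  by (induction n) auto

lemma relpow_iff:
  "u \<in> verts G \<Longrightarrow> (u, v) \<in> arcs_ends G ^^ n \<longleftrightarrow> v = (succ ^^ n) u"
  by (induction n arbitrary: v) (auto simp: dominates_iff relcomp_unfold)

lemma reachable_iff: "u \<rightarrow>\<^sup>*\<^bsub>G\<^esub> v \<longleftrightarrow> u \<in> verts G \<and> (\<exists>n. v = (succ ^^ n) u)"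
proof (cases "u \<in> verts G")
  case True
  then show ?thesis
    by (simp add: reachable_conv' rtrancl_power relpow_iff)
qed (auto dest: reachable_in_verts)

text \<open>
  A walk has no choice: it consists of the iterated successors of its first vertex.
\<close>

lemma cas_succ:
  "cas u p v \<Longrightarrow> set p \<subseteq> arcs G \<Longrightarrow>
    v = (succ ^^ length p) u \<and> map (tail G) p = map (\<lambda>i. (succ ^^ i) u) [0..<length p]"
proof (induction p arbitrary: u)
  case (Cons e p)
  then have "u \<rightarrow>\<^bsub>G\<^esub> head G e"
    by (auto simp: arcs_ends_conv)
  then have "head G e = succ u"
    by (simp add: dominates_iff)
  then have "v = (succ ^^ length p) (succ u)"
    "map (tail G) p = map (\<lambda>i. (succ ^^ i) (succ u)) [0..<length p]"
    using Cons.IH[of "head G e"] Cons.prems by auto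
  moreover have "tail G e = u"
    using Cons.prems by simp
  moreover have "[0..<Suc n] = 0 # map Suc [0..<n]" for n
    by (simp add: map_Suc_upt upt_conv_Cons del: upt_Suc)
  ultimately show ?case
    by (simp add: funpow_Suc_right o_def del: funpow.simps(2) upt_Suc)
qed auto

lemma cycle_succ:
  assumes "cycle p"
  obtains u where "u \<in> verts G" "p \<noteq> []" "(succ ^^ length p) u = u"
    "map (tail G) p = map (\<lambda>i. (succ ^^ i) u) [0..<length p]" "distinct (map (tail G) p)"
proof -
  from assms obtain u where u: "awalk u p u" "distinct (tl (awalk_verts u p))" "p \<noteq> []"
    by (auto simp: cycle_def)
  then have c: "cas u p u" "set p \<subseteq> arcs G" "u \<in> verts G"
    by (auto simp: awalk_def)
  have "awalk_verts u p = map (tail G) p @ [u]"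
    using u awlast_if_cas[OF c(1)] by (auto simp: awalk_verts_conv)
  moreover have "tail G (hd p) = u"
    using c(1) u(3) by (cases p) auto
  ultimately have "distinct (map (tail G) p)"
    using u(2,3) by (cases p) auto
  with cas_succ[OF c(1,2)] c(3) u(3) show thesis
    using that by auto
qed

lemma cycle_enumeration:
  shows m_pos: "m > 0" and z_eq_funpow: "i < m \<Longrightarrow> z i = (succ ^^ i) (z 0)"
    and funpow_m: "(succ ^^ m) (z 0) = z 0" and z0_in_verts: "z 0 \<in> verts G"
    and inj_z: "inj_on z {..<m}"
proof -
  from directed_cycle obtain p where p: "cycle p" "map (tail G) p = map z [0..<m]"
    by (auto simp: directed_cycle_def)
  from cycle_succ[OF p(1)] obtain u where u: "u \<in> verts G" "p \<noteq> []" "(succ ^^ length p) u = u"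
    "map (tail G) p = map (\<lambda>i. (succ ^^ i) u) [0..<length p]" "distinct (map (tail G) p)" .
  have len: "length p = m"
    using arg_cong[OF p(2), of length] by simp
  then show "m > 0" using u(2) by auto
  have "map z [0..<m] = map (\<lambda>i. (succ ^^ i) u) [0..<m]"
    using u(4) unfolding p(2) len .
  then have *: "z i = (succ ^^ i) u" if "i < m" for i
    using that by simp
  with \<open>m > 0\<close> have "z 0 = u" by simp
  with * u(1,3) len show "i < m \<Longrightarrow> z i = (succ ^^ i) (z 0)" "(succ ^^ m) (z 0) = z 0" "z 0 \<in> verts G"
    by auto
  show "inj_on z {..<m}"
    using u(5) p(2) by (simp add: distinct_map lessThan_atLeast0)
qed


section \<open>The cycle, heights and roots\<close>

text \<open>
  Integer indices avoid truncated subtraction when the index \<open>i + k - h + 1\<close> is formed.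
\<close>

definition cyc :: "int \<Rightarrow> 'a" where
  "cyc j = z (nat (j mod int m))"

lemma cyc_z: "i < m \<Longrightarrow> cyc (int i) = z i"
  by (simp add: cyc_def)

lemma cyc_eq_iff: "cyc a = cyc b \<longleftrightarrow> [a = b] (mod int m)"
proof -
  have "nat (a mod int m) \<in> {..<m}" for a
    using m_pos by (simp add: nat_less_iff)
  then show ?thesis
    using m_pos inj_on_eq_iff[OF inj_z] by (simp add: cyc_def cong_def eq_nat_nat_iff)
qed

lemma cyc_int: "cyc (int n) = (succ ^^ n) (z 0)"
proof -
  have "nat (int n mod int m) = n mod m"
    by (metis zmod_int nat_int)
  then have "cyc (int n) = (succ ^^ (n mod m)) (z 0)"
    using m_pos z_eq_funpow[of "n mod m"] by (simp add: cyc_def)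
  also have "\<dots> = (succ ^^ n) (z 0)"
    using funpow_mod_eq[OF funpow_m] by simp
  finally show ?thesis .
qed

lemma cyc_obtain_nat: obtains n where "n < m" "[int n = j] (mod int m)" "cyc j = z n"
proof
  show "nat (j mod int m) < m" "[int (nat (j mod int m)) = j] (mod int m)"
    "cyc j = z (nat (j mod int m))"
    using m_pos by (simp_all add: nat_less_iff cong_def cyc_def)
qed

lemma range_cyc: "range cyc = z ` {..<m}"
proof
  show "range cyc \<subseteq> z ` {..<m}"
  proof
    fix v assume "v \<in> range cyc"
    then obtain j where "v = cyc j" by blast
    moreover obtain n where "n < m" "cyc j = z n"
      by (rule cyc_obtain_nat)
    ultimately show "v \<in> z ` {..<m}" by simp
  qed
  show "z ` {..<m} \<subseteq> range cyc"
    by (auto simp: cyc_z[symmetric])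
qed

lemma cyc_in_verts [simp]: "cyc j \<in> verts G"
proof -
  obtain n where "n < m" "cyc j = z n"
    by (rule cyc_obtain_nat)
  then show ?thesis
    using z_eq_funpow[of n] z0_in_verts by (metis funpow_succ_in_verts)
qed

lemma succ_cyc: "succ (cyc j) = cyc (j + 1)"
proof -
  obtain n where n: "[int n = j] (mod int m)"
    by (rule cyc_obtain_nat)
  then have "succ (cyc j) = succ (cyc (int n))"
    by (metis cyc_eq_iff)
  also have "\<dots> = cyc (int (Suc n))"
    by (simp only: cyc_int funpow.simps o_apply)
  also have "\<dots> = cyc (j + 1)"
    using cong_add[OF n cong_refl[of 1]] by (simp add: cyc_eq_iff add.commute)
  finally show ?thesis .
qed

lemma funpow_cyc: "(succ ^^ n) (cyc j) = cyc (j + int n)"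
  by (induction n) (auto simp: succ_cyc algebra_simps)

text \<open>
  Having a forward path to the cycle is inherited along an arc in both directions, hence along
  every walk of the underlying undirected graph; and that graph is connected.
\<close>

lemma reaches_cycle:
  assumes "v \<in> verts G"
  shows "\<exists>n. (succ ^^ n) v \<in> range cyc"
proof -
  have "z 0 \<rightarrow>\<^sup>*\<^bsub>with_proj (mk_symmetric G)\<^esub> v"
    using pseudocycle assms z0_in_verts
    by (auto simp: pseudocycle_def connected_def strongly_connected_def)
  then have "(z 0, v) \<in> (arcs_ends (with_proj (mk_symmetric G)))\<^sup>*"
    by (rule reachable_rtranclI)
  then show ?thesis
  proof induction
    case base
    have "(succ ^^ 0) (z 0) \<in> range cyc"
      using cyc_z[OF m_pos] by (metis funpow_0 rangeI)
    then show ?case by blast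
  next
    case (step u w)
    then obtain n where n: "(succ ^^ n) u \<in> range cyc" by blast
    from step.hyps consider "u \<rightarrow>\<^bsub>G\<^esub> w" | "w \<rightarrow>\<^bsub>G\<^esub> u"
      by (auto simp: parcs_mk_symmetric arcs_ends_conv)
    then show ?case
    proof cases
      case 1
      then have "(succ ^^ n) w = succ ((succ ^^ n) u)"
        by (simp add: dominates_iff funpow_swap1)
      with n show ?thesis by (auto simp: succ_cyc intro!: exI[of _ n])
    next
      case 2
      then have "(succ ^^ Suc n) w = (succ ^^ n) u"
        by (simp add: dominates_iff funpow_swap1)
      with n show ?thesis by metis
    qed
  qed
qed

text \<open>
  The orbit of a periodic vertex meets the cycle and returns to the vertex without leaving the
  cycle again.
\<close>

lemma periodic_in_cycle:
  assumes "v \<in> verts G" "n > 0" "(succ ^^ n) v = v"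
  shows "v \<in> range cyc"
proof -
  obtain k j where k: "(succ ^^ k) v = cyc j"
    using reaches_cycle[OF assms(1)] by blast
  have "(succ ^^ (n * k)) v = v" for k
    using funpow_mod_eq[OF assms(3), of "n * k"] by simp
  moreover have "n * k = (n * k - k) + k" using \<open>n > 0\<close> by (cases n) auto
  ultimately have "v = (succ ^^ (n * k - k)) ((succ ^^ k) v)"
    by (simp add: funpow_funpow)
  then show ?thesis by (simp add: k funpow_cyc)
qed

lemma cycle_verts_eq: "cycle_verts G = range cyc"
proof
  show "cycle_verts G \<subseteq> range cyc"
  proof
    fix v assume "v \<in> cycle_verts G"
    then obtain p where p: "cycle p" "v \<in> set (map (tail G) p)"
      by (auto simp: cycle_verts_def)
    from cycle_succ[OF p(1)] obtain u where u: "u \<in> verts G" "p \<noteq> []" "(succ ^^ length p) u = u"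
      "map (tail G) p = map (\<lambda>i. (succ ^^ i) u) [0..<length p]" .
    from p(2) obtain i where "v = (succ ^^ i) u"
      unfolding u(4) by auto
    moreover have "(succ ^^ length p) ((succ ^^ i) u) = (succ ^^ i) ((succ ^^ length p) u)"
      by (simp add: funpow_funpow add.commute)
    ultimately show "v \<in> range cyc"
      using u by (intro periodic_in_cycle[of v "length p"]) auto
  qed
next
  from directed_cycle obtain p where p: "cycle p" "map (tail G) p = map z [0..<m]"
    by (auto simp: directed_cycle_def)
  have "range cyc = set (map (tail G) p)"
    unfolding p(2) range_cyc by auto
  then show "range cyc \<subseteq> cycle_verts G"
    using p(1) by (auto simp: cycle_verts_def)
qed

lemma height_eq: "v \<in> verts G \<Longrightarrow> height G v = (LEAST n. (succ ^^ n) v \<in> range cyc)"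
  by (simp add: height_def cycle_verts_eq relpow_iff Bex_def)

lemma height_le: "v \<in> verts G \<Longrightarrow> (succ ^^ n) v \<in> range cyc \<Longrightarrow> height G v \<le> n"
  by (simp add: height_eq Least_le)

text \<open>
  The cycle vertex \<open>z\<^sub>i\<close> such that \<open>v\<close> belongs to the tree \<open>T\<^sub>i\<close>.
\<close>

definition root :: "'a \<Rightarrow> 'a" where
  "root v = (succ ^^ height G v) v"

lemma root_in_cycle: "v \<in> verts G \<Longrightarrow> root v \<in> range cyc"
  unfolding root_def by (simp only: height_eq) (rule LeastI_ex[OF reaches_cycle])

lemma root_in_verts [simp]: "v \<in> verts G \<Longrightarrow> root v \<in> verts G"
  by (simp add: root_def)

lemma height_0_iff: "v \<in> verts G \<Longrightarrow> height G v = 0 \<longleftrightarrow> v \<in> range cyc"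
  using height_le[of v 0] root_in_cycle[of v] by (auto simp: root_def)

lemma height_cyc [simp]: "height G (cyc j) = 0"
  by (simp add: height_0_iff)

lemma root_cyc [simp]: "root (cyc j) = cyc j"
  by (simp add: root_def)

lemma funpow_in_cycle_iff:
  assumes "v \<in> verts G" shows "(succ ^^ n) v \<in> range cyc \<longleftrightarrow> height G v \<le> n"
proof
  assume "height G v \<le> n"
  then have "(succ ^^ n) v = (succ ^^ (n - height G v)) (root v)"
    by (simp add: root_def funpow_funpow)
  then show "(succ ^^ n) v \<in> range cyc"
    using root_in_cycle[OF assms] by (auto simp: funpow_cyc)
qed (rule height_le[OF assms])

lemma height_funpow:
  assumes "v \<in> verts G" shows "height G ((succ ^^ n) v) = height G v - n"
proof -
  have "height G ((succ ^^ n) v) \<le> k \<longleftrightarrow> height G v - n \<le> k" for k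
  proof -
    have "height G ((succ ^^ n) v) \<le> k \<longleftrightarrow> (succ ^^ (k + n)) v \<in> range cyc"
      using assms funpow_in_cycle_iff[of "(succ ^^ n) v" k] by (simp add: funpow_funpow)
    also have "\<dots> \<longleftrightarrow> height G v - n \<le> k"
      using assms by (simp add: funpow_in_cycle_iff le_diff_conv)
    finally show ?thesis .
  qed
  from this[of "height G v - n"] this[of "height G ((succ ^^ n) v)"] show ?thesis
    by simp
qed

lemma height_succ: "v \<in> verts G \<Longrightarrow> height G (succ v) = height G v - 1"
  using height_funpow[of v 1] by simp

lemma root_funpow:
  assumes "v \<in> verts G" "n \<le> height G v" shows "root ((succ ^^ n) v) = root v"
  using assms by (simp add: root_def height_funpow funpow_funpow)

lemma root_succ: "v \<in> verts G \<Longrightarrow> v \<notin> range cyc \<Longrightarrow> root (succ v) = root v"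
  using root_funpow[of v 1] height_0_iff[of v] by (simp add: Suc_le_eq)

lemma root_eq_self_iff: "v \<in> verts G \<Longrightarrow> root v = v \<longleftrightarrow> v \<in> range cyc"
  using root_in_cycle[of v] by auto



section \<open>Offsets\<close>

text \<open>
  From the time that it is on the cycle, \<open>v\<close> moves in step with the cycle vertex \<open>cyc (offset v)\<close>.
  Only the residue of the offset modulo \<open>m\<close> is meaningful. Unlike the pair of root and height, it
  changes uniformly along all arcs, whether or not they lie on the cycle.
\<close>

definition offset :: "'a \<Rightarrow> int" where
  "offset v = (SOME j. root v = cyc j) - int (height G v)"

lemma root_offset:
  assumes "v \<in> verts G" shows "root v = cyc (offset v + int (height G v))"
proof -
  have "\<exists>j. root v = cyc j"
    using root_in_cycle[OF assms] by auto
  then have "root v = cyc (SOME j. root v = cyc j)"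
    by (rule someI_ex)
  then show ?thesis by (simp add: offset_def)
qed

lemma funpow_offset:
  assumes "v \<in> verts G" "height G v \<le> n" shows "(succ ^^ n) v = cyc (offset v + int n)"
proof -
  have "(succ ^^ n) v = (succ ^^ (n - height G v)) (root v)"
    using assms(2) by (simp add: root_def funpow_funpow)
  then show ?thesis
    using assms(2) by (simp add: root_offset[OF assms(1)] funpow_cyc of_nat_diff)
qed

text \<open>
  The offset can be read off from any single position late enough to lie on the cycle.
\<close>

lemma offset_congI:
  assumes "v \<in> verts G" "height G v \<le> n" "(succ ^^ n) v = cyc (j + int n)"
  shows "[offset v = j] (mod int m)"
  using assms funpow_offset[OF assms(1,2)] by (simp add: cyc_eq_iff cong_add_rcancel)

lemma offset_cyc: "[offset (cyc j) = j] (mod int m)"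
  by (rule offset_congI[of _ 0]) auto

lemma offset_succ:
  assumes "v \<in> verts G" shows "[offset (succ v) = offset v + 1] (mod int m)"
proof (rule offset_congI[of _ "height G v"])
  have "(succ ^^ height G v) (succ v) = (succ ^^ Suc (height G v)) v"
    by (simp add: funpow_swap1)
  then show "(succ ^^ height G v) (succ v) = cyc (offset v + 1 + int (height G v))"
    using funpow_offset[OF assms, of "Suc (height G v)"] by (simp add: algebra_simps)
qed (use assms height_succ in auto)


section \<open>Trees, truncated trees and subtrees in terms of the successor map\<close>

lemma cycle_tree_eq:
  "cycle_tree G c = (G \<restriction> {v \<in> verts G. root v = c})
     \<lparr>arcs := arcs (G \<restriction> {v \<in> verts G. root v = c})
        - out_arcs (G \<restriction> {v \<in> verts G. root v = c}) c\<rparr>"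
proof -
  have "{v \<in> verts G. (v, c) \<in> arcs_ends G ^^ height G v} = {v \<in> verts G. root v = c}"
    by (auto simp: relpow_iff root_def)
  then show ?thesis
    by (simp add: cycle_tree_def Let_def)
qed

lemma verts_cycle_tree: "verts (cycle_tree G c) = {v \<in> verts G. root v = c}"
  by (simp add: cycle_tree_eq)

text \<open>
  Off the cycle a step does not change the root and so stays in the tree; the tree therefore loses
  no arcs of its vertices except the one that leaves \<open>c\<close>.
\<close>

lemma dominates_cycle_tree_iff:
  assumes "c \<in> range cyc"
  shows "u \<rightarrow>\<^bsub>cycle_tree G c\<^esub> v \<longleftrightarrow> u \<in> verts G \<and> root u = c \<and> u \<noteq> c \<and> v = succ u"
proof -
  have "u \<notin> range cyc" if "u \<in> verts G" "root u = c" "u \<noteq> c"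
    using that root_eq_self_iff by auto
  then show ?thesis
    unfolding cycle_tree_eq dominates_remove_out_arcs_iff dominates_induce_iff dominates_iff
    by (auto simp: root_succ)
qed

lemma wf_cycle_tree: "wf_digraph (cycle_tree G c)"
  by unfold_locales (auto simp: cycle_tree_eq)

text \<open>
  Up to the root, the forward path of \<open>v\<close> in the digraph is its forward path in the tree, so
  distances and the order in the tree can be computed with the successor map.
\<close>

lemma cycle_tree_relpowI:
  assumes "v \<in> verts G" "n \<le> height G v"
  shows "(v, (succ ^^ n) v) \<in> arcs_ends (cycle_tree G (root v)) ^^ n"
  using assms(2)
proof (induction n)
  case (Suc n)
  have "height G ((succ ^^ n) v) \<noteq> 0"
    using Suc.prems assms(1) by (simp add: height_funpow)
  then have "(succ ^^ n) v \<noteq> root v"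
    using height_0_iff[of "(succ ^^ n) v"] root_in_cycle[OF assms(1)] assms(1) by auto
  then have "(succ ^^ n) v \<rightarrow>\<^bsub>cycle_tree G (root v)\<^esub> (succ ^^ Suc n) v"
    using Suc.prems assms(1)
    by (simp add: dominates_cycle_tree_iff root_in_cycle root_funpow)
  with Suc show ?case by auto
qed auto

lemma cycle_tree_relpowD:
  assumes "(u, v) \<in> arcs_ends (cycle_tree G c) ^^ n" "c \<in> range cyc" "u \<in> verts G"
  shows "v = (succ ^^ n) u"
  using assms(1)
  by (induction n arbitrary: v) (auto simp: dominates_cycle_tree_iff[OF assms(2)])

lemma tree_dist_cycle_tree:
  assumes "v \<in> verts G" shows "tree_dist (cycle_tree G (root v)) v (root v) = height G v"
  unfolding tree_dist_def
proof (rule Least_equality)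
  show "(v, root v) \<in> arcs_ends (cycle_tree G (root v)) ^^ height G v"
    using cycle_tree_relpowI[OF assms, of "height G v"] by (simp add: root_def)
next
  fix n assume "(v, root v) \<in> arcs_ends (cycle_tree G (root v)) ^^ n"
  then show "height G v \<le> n"
    using assms cycle_tree_relpowD[of v "root v" n "root v"] root_in_cycle[OF assms]
    by (intro height_le) auto
qed

lemma tree_less_cycle_tree_iff:
  assumes "x \<in> verts G" "y \<in> verts G" "root x = c" "root y = c" "x \<noteq> c"
  shows "tree_less (cycle_tree G c) x y \<longleftrightarrow> x \<noteq> y \<and> (\<exists>n. (succ ^^ n) y = x)"
proof -
  have c: "c \<in> range cyc"
    using assms root_in_cycle by auto
  have "(\<exists>n. (y, x) \<in> arcs_ends (cycle_tree G c) ^^ n) \<longleftrightarrow> (\<exists>n. (succ ^^ n) y = x)"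
  proof
    assume "\<exists>n. (succ ^^ n) y = x"
    then obtain n where n: "(succ ^^ n) y = x" ..
    have "x \<notin> range cyc"
      using assms root_eq_self_iff by auto
    then have "n \<le> height G y"
      using n funpow_in_cycle_iff[OF assms(2), of n] by auto
    then show "\<exists>n. (y, x) \<in> arcs_ends (cycle_tree G c) ^^ n"
      using cycle_tree_relpowI[OF assms(2), of n] n assms(4) by auto
  qed (use cycle_tree_relpowD[OF _ c assms(2)] in blast)
  moreover have "y \<in> verts (cycle_tree G c)"
    using assms by (simp add: verts_cycle_tree)
  ultimately show ?thesis
    by (auto simp: tree_less_def tree_le_def rtrancl_power
        wf_digraph.reachable_conv'[OF wf_cycle_tree])
qed

lemma Inc_cycle_tree_iff:
  "A \<in> Inc (cycle_tree G c) c \<longleftrightarrow> A \<subseteq> {v \<in> verts G. root v = c \<and> v \<noteq> c}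
    \<and> (\<forall>x \<in> A. \<forall>y \<in> A. \<forall>n. (succ ^^ n) y = x \<longrightarrow> x = y)"
proof (cases "A \<subseteq> {v \<in> verts G. root v = c \<and> v \<noteq> c}")
  case True
  then have "(x \<noteq> y \<longrightarrow> \<not> tree_less (cycle_tree G c) x y)
      \<longleftrightarrow> (\<forall>n. (succ ^^ n) y = x \<longrightarrow> x = y)" if "x \<in> A" "y \<in> A" for x y
    using that tree_less_cycle_tree_iff[of x y c] by blast
  then have "(\<forall>x \<in> A. \<forall>y \<in> A. x \<noteq> y \<longrightarrow> \<not> tree_less (cycle_tree G c) x y)
      \<longleftrightarrow> (\<forall>x \<in> A. \<forall>y \<in> A. \<forall>n. (succ ^^ n) y = x \<longrightarrow> x = y)"
    by (intro ball_cong refl)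
  moreover have "A \<subseteq> verts (cycle_tree G c) - {c}"
    using True by (auto simp: verts_cycle_tree)
  ultimately show ?thesis
    using True unfolding Inc_def mem_Collect_eq by blast
qed (auto simp: Inc_def verts_cycle_tree)

definition truncated :: "'a \<Rightarrow> ('a,'b) pre_digraph" where
  "truncated c = pre_digraph.del_vert (cycle_tree G c) c"

lemma verts_truncated: "verts (truncated c) = {v \<in> verts G. root v = c \<and> v \<noteq> c}"
  by (auto simp: truncated_def pre_digraph.del_vert_simps verts_cycle_tree)

lemma dominates_truncated_iff:
  assumes "c \<in> range cyc"
  shows "u \<rightarrow>\<^bsub>truncated c\<^esub> v \<longleftrightarrow> u \<in> verts (truncated c) \<and> v = succ u \<and> v \<noteq> c"
  using assms
  by (auto simp: truncated_def[of c] dominates_del_vert_iff dominates_cycle_tree_iff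
      pre_digraph.del_vert_simps verts_cycle_tree)

text \<open>
  Deleting the root turns its children into the roots of the components. This is why
  root-preserving homomorphisms into a truncated tree produce vertices of height one.
\<close>

lemma forest_roots_truncated:
  assumes "c \<in> range cyc"
  shows "forest_roots (truncated c) = {v \<in> verts G. root v = c \<and> height G v = 1}"
proof -
  have "v \<noteq> c \<and> succ v = c \<longleftrightarrow> height G v = 1" if v: "v \<in> verts G" "root v = c" for v
  proof
    assume "v \<noteq> c \<and> succ v = c"
    then have "height G v \<noteq> 0" "height G v - 1 = 0"
      using v assms height_0_iff[of v] root_eq_self_iff[of v] height_succ[of v] height_0_iff[of c]
      by auto
    then show "height G v = 1" by simp
  next
    assume "height G v = 1"
    then show "v \<noteq> c \<and> succ v = c"
      using v assms by (auto simp: root_def)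
  qed
  then show ?thesis
    using assms
    by (auto simp: forest_roots_def out_arcs_empty_iff dominates_truncated_iff verts_truncated)
qed

lemma verts_subtree: "verts (subtree G x) = {y \<in> verts G. \<exists>n. (succ ^^ n) y = x}"
  by (auto simp: subtree_def reachable_iff)

lemma self_in_subtree: "x \<in> verts G \<Longrightarrow> x \<in> verts (subtree G x)"
  by (auto simp: verts_subtree intro: exI[of _ 0])

lemma dominates_subtree_iff:
  "u \<rightarrow>\<^bsub>subtree G x\<^esub> v \<longleftrightarrow> u \<in> verts (subtree G x) \<and> v \<in> verts (subtree G x) \<and> v = succ u"
  unfolding subtree_def by (auto simp: dominates_induce_iff dominates_iff)

lemma succ_in_subtree:
  assumes "y \<in> verts (subtree G x)" "y \<noteq> x"
  shows "succ y \<in> verts (subtree G x)"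
proof -
  from assms(1) obtain n where n: "y \<in> verts G" "(succ ^^ n) y = x"
    by (auto simp: verts_subtree)
  with assms(2) obtain k where "n = Suc k" by (cases n) auto
  with n show ?thesis by (auto simp: verts_subtree funpow_swap1)
qed

text \<open>
  Otherwise \<open>x\<close> would be periodic. Consequently \<open>x\<close> is a sink of its subtree.
\<close>

lemma succ_notin_subtree:
  assumes "x \<in> verts G" "x \<notin> range cyc"
  shows "succ x \<notin> verts (subtree G x)"
proof
  assume "succ x \<in> verts (subtree G x)"
  then obtain n where "(succ ^^ n) (succ x) = x"
    by (auto simp: verts_subtree)
  then have "(succ ^^ Suc n) x = x"
    by (simp add: funpow_swap1)
  with periodic_in_cycle[OF assms(1), of "Suc n"] assms(2) show False
    by simp
qed

lemma forest_roots_subtree: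
  assumes "x \<in> verts G" "x \<notin> range cyc" shows "forest_roots (subtree G x) = {x}"
proof -
  have "v \<in> forest_roots (subtree G x) \<longleftrightarrow> v = x" for v
    using assms succ_in_subtree[of v x] succ_notin_subtree[of x] self_in_subtree[of x]
    by (auto simp: forest_roots_def out_arcs_empty_iff dominates_subtree_iff)
  then show ?thesis by auto
qed

end



section \<open>How homomorphisms move offsets\<close>

locale pseudocycle_pair =
  S: pseudocycle_graph P m z + T: pseudocycle_graph P' l z'
  for P :: "('a,'b) pre_digraph" and m z and P' :: "('c,'d) pre_digraph" and l z' +
  assumes l_dvd_m: "l dvd m"
begin

lemma digraph_Hom_iff:
  "g \<in> digraph_Hom P P' \<longleftrightarrow>
    g \<in> verts P \<rightarrow>\<^sub>E verts P' \<and> (\<forall>v \<in> verts P. g (S.succ v) = T.succ (g v))"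
  by (auto simp: digraph_Hom_def S.dominates_iff T.dominates_iff)

lemma Hom_in_verts [simp]: "g \<in> digraph_Hom P P' \<Longrightarrow> v \<in> verts P \<Longrightarrow> g v \<in> verts P'"
  by (auto simp: digraph_Hom_iff)

lemma Hom_funpow:
  assumes "g \<in> digraph_Hom P P'" "v \<in> verts P"
  shows "g ((S.succ ^^ n) v) = (T.succ ^^ n) (g v)"
  using assms by (induction n) (auto simp: digraph_Hom_iff)

text \<open>
  The divisibility of the cycle lengths makes positions modulo \<open>m\<close> on the first cycle determine
  positions modulo \<open>l\<close> on the second.
\<close>

lemma cong_l: "[a = b] (mod int m) \<Longrightarrow> [a = b] (mod int l)"
  using l_dvd_m cong_dvd_modulus by (metis int_dvd_int_iff)

lemma T_cyc_eq: "[a = b] (mod int m) \<Longrightarrow> T.cyc (a + k) = T.cyc (b + k)"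
  by (simp add: T.cyc_eq_iff cong_add_rcancel cong_l)

lemma Hom_z0_in_cycle:
  assumes "g \<in> digraph_Hom P P'" shows "g (z 0) \<in> T.cyc ` int ` {..<l}"
proof -
  have "(T.succ ^^ m) (g (z 0)) = g (z 0)"
    using Hom_funpow[OF assms S.z0_in_verts, of m] S.funpow_m by simp
  then have "g (z 0) \<in> range T.cyc"
    using assms S.z0_in_verts S.m_pos by (intro T.periodic_in_cycle[of _ m]) auto
  then show ?thesis
    by (auto simp: T.range_cyc T.cyc_z image_image)
qed

lemma Hom_cyc:
  assumes "g \<in> Hom_at P P' (z 0) (T.cyc k)" shows "g (S.cyc j) = T.cyc (j + k)"
proof -
  obtain n where n: "[int n = j] (mod int m)" "S.cyc j = z n" "n < m"
    by (rule S.cyc_obtain_nat)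
  then have "g (S.cyc j) = g ((S.succ ^^ n) (z 0))"
    using S.z_eq_funpow[of n] by simp
  also have "\<dots> = T.cyc (k + int n)"
    using assms S.z0_in_verts Hom_funpow[of g "z 0" n] by (simp add: Hom_at_def T.funpow_cyc)
  also have "\<dots> = T.cyc (j + k)"
    using T_cyc_eq[OF n(1), of k] by (simp add: add.commute)
  finally show ?thesis .
qed

text \<open>
  When \<open>v\<close> reaches the cycle, so does its image.
\<close>

lemma Hom_height_le:
  assumes "g \<in> Hom_at P P' (z 0) (T.cyc k)" "v \<in> verts P"
  shows "height P' (g v) \<le> height P v"
proof -
  have g: "g \<in> digraph_Hom P P'"
    using assms(1) by (simp add: Hom_at_def)
  have "(T.succ ^^ height P v) (g v) = g (S.root v)"
    by (simp add: S.root_def Hom_funpow[OF g assms(2)])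
  also have "\<dots> \<in> range T.cyc"
    using Hom_cyc[OF assms(1)] S.root_offset[OF assms(2)] by simp
  finally show ?thesis
    using assms(2) g by (simp add: T.height_le)
qed

text \<open>
  After \<open>height P v\<close> steps both \<open>v\<close> and \<open>g v\<close> are on the cycles, where \<open>g\<close> is the shift by \<open>k\<close>.
\<close>

lemma Hom_offset:
  assumes "g \<in> Hom_at P P' (z 0) (T.cyc k)" "v \<in> verts P"
  shows "[T.offset (g v) = S.offset v + k] (mod int l)"
proof (rule T.offset_congI)
  have g: "g \<in> digraph_Hom P P'"
    using assms(1) by (simp add: Hom_at_def)
  then show "g v \<in> verts P'"
    using assms(2) by simp
  show "height P' (g v) \<le> height P v"
    by (rule Hom_height_le[OF assms])
  have "(T.succ ^^ height P v) (g v) = g (S.root v)"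
    by (simp add: S.root_def Hom_funpow[OF g assms(2)])
  then show "(T.succ ^^ height P v) (g v) = T.cyc (S.offset v + k + int (height P v))"
    using Hom_cyc[OF assms(1)] S.root_offset[OF assms(2)] by (simp add: algebra_simps)
qed

text \<open>
  For height zero of the image this determines \<open>g v\<close> itself; for height one it names the tree
  into which \<open>g\<close> sends the subtree above \<open>v\<close>.
\<close>

lemma Hom_root:
  assumes "g \<in> Hom_at P P' (z 0) (T.cyc k)" "v \<in> verts P"
  shows "T.root (g v) = T.cyc (S.offset v + k + int (height P' (g v)))"
proof -
  have "g v \<in> verts P'"
    using assms by (simp add: Hom_at_def)
  then show ?thesis
    using Hom_offset[OF assms] by (simp add: T.root_offset T.cyc_eq_iff cong_add_rcancel)
qed

text \<open>
  The root of the tree that receives the subtree above \<open>x\<close> when \<open>g x\<close> has height one. In terms of the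
  distance \<open>h\<close> of \<open>x\<close> from \<open>z\<^sub>i\<close> its index is \<open>i + k - h + 1\<close>.
\<close>

definition target :: "int \<Rightarrow> 'a \<Rightarrow> 'c" where
  "target k x = T.cyc (S.offset x + k + 1)"

lemma target_in_cycle [simp]: "target k x \<in> range T.cyc"
  by (simp add: target_def)


section \<open>Cutting a homomorphism into pieces and gluing the pieces\<close>

lemma forest_Hom_subtree_iff:
  assumes "x \<in> verts P" "x \<notin> range S.cyc" "c \<in> range T.cyc"
  shows "f \<in> forest_Hom (subtree P x) (T.truncated c) \<longleftrightarrow>
    f \<in> verts (subtree P x) \<rightarrow>\<^sub>E verts (T.truncated c) \<and> height P' (f x) = 1
    \<and> (\<forall>y \<in> verts (subtree P x) - {x}. f (S.succ y) = T.succ (f y))"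
    (is "?L \<longleftrightarrow> ?R")
proof
  assume ?L
  then show ?R
    using assms S.succ_in_subtree[of _ x]
    by (auto simp: forest_Hom_def digraph_Hom_def S.dominates_subtree_iff T.dominates_truncated_iff
        S.forest_roots_subtree T.forest_roots_truncated)
next
  assume R: ?R
  have "f u \<rightarrow>\<^bsub>T.truncated c\<^esub> f v" if "u \<rightarrow>\<^bsub>subtree P x\<^esub> v" for u v
  proof -
    have "u \<noteq> x" "u \<in> verts (subtree P x)" "v \<in> verts (subtree P x)" "v = S.succ u"
      using that S.succ_notin_subtree[OF assms(1,2)] by (auto simp: S.dominates_subtree_iff)
    with R show ?thesis
      using assms(3) by (auto simp: T.dominates_truncated_iff T.verts_truncated PiE_iff)
  qed
  moreover have "f x \<in> verts (T.truncated c)"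
    using R S.self_in_subtree[OF assms(1)] by auto
  ultimately show ?L
    using R assms
    by (simp add: forest_Hom_def digraph_Hom_def S.forest_roots_subtree T.forest_roots_truncated
        T.verts_truncated)
qed

text \<open>
  A vertex \<open>n\<close> steps above \<open>x\<close> has an image \<open>n\<close> steps above \<open>g x\<close>. Since \<open>g x\<close> is off the cycle,
  that image is off the cycle too and has the same root.
\<close>

lemma restrict_Hom_in_forest_Hom:
  assumes "g \<in> Hom_at P P' (z 0) (T.cyc k)" "x \<in> verts P" "x \<notin> range S.cyc"
    and "height P' (g x) = 1"
  shows "restrict g (verts (subtree P x))
    \<in> forest_Hom (subtree P x) (T.truncated (target k x))"
proof -
  have g: "g \<in> digraph_Hom P P'"
    using assms(1) by (simp add: Hom_at_def)
  have "g y \<in> verts (T.truncated (target k x))" if y: "y \<in> verts (subtree P x)" for y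
  proof -
    from y obtain n where n: "y \<in> verts P" "(S.succ ^^ n) y = x"
      by (auto simp: S.verts_subtree)
    have gy: "g y \<in> verts P'" "(T.succ ^^ n) (g y) = g x"
      using Hom_funpow[OF g n(1), of n] g n by auto
    then have "height P' (g y) - n = 1"
      using T.height_funpow[OF gy(1), of n] assms(4) by simp
    moreover from this have "T.root (g y) = T.root (g x)"
      using T.root_funpow[OF gy(1), of n] gy(2) by simp
    moreover have "T.root (g x) = target k x"
      using Hom_root[OF assms(1,2)] assms(4) by (simp add: target_def)
    ultimately show ?thesis
      using gy(1) T.height_0_iff[OF gy(1)] by (auto simp: T.verts_truncated)
  qed
  then show ?thesis
    using assms g S.self_in_subtree[OF assms(2)] S.succ_in_subtree[of _ x]
    by (auto simp: forest_Hom_subtree_iff digraph_Hom_iff S.verts_subtree)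
qed

text \<open>
  Along the forward path of \<open>v\<close> the height of the image drops by one with each step, so it passes
  through one.
\<close>

lemma positive_height_in_subtree:
  assumes "g \<in> Hom_at P P' (z 0) (T.cyc k)" "v \<in> verts P" "height P' (g v) > 0"
  obtains x where "x \<in> verts P" "x \<notin> range S.cyc" "height P' (g x) = 1"
    "v \<in> verts (subtree P x)"
proof
  let ?n = "height P' (g v) - 1" let ?x = "(S.succ ^^ ?n) v"
  have g: "g \<in> digraph_Hom P P'"
    using assms(1) by (simp add: Hom_at_def)
  show "?x \<in> verts P" "v \<in> verts (subtree P ?x)"
    using assms(2) by (auto simp: S.verts_subtree)
  show "?x \<notin> range S.cyc"
    using S.funpow_in_cycle_iff[OF assms(2), of ?n] Hom_height_le[OF assms(1,2)] assms(3) by simp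
  show "height P' (g ?x) = 1"
    using Hom_funpow[OF g assms(2), of ?n] T.height_funpow[of "g v" ?n] g assms(2,3) by simp
qed

text \<open>
  A vertex whose images both have height zero is sent to the cycle vertex given by its offset; every
  other vertex lies in one of the subtrees on which the two homomorphisms agree.
\<close>

lemma Hom_at_eqI:
  assumes g: "g \<in> Hom_at P P' (z 0) (T.cyc k)" and h: "h \<in> Hom_at P P' (z 0) (T.cyc k)"
    and heights: "\<And>x. x \<in> verts P \<Longrightarrow> x \<notin> range S.cyc
      \<Longrightarrow> height P' (g x) = 1 \<longleftrightarrow> height P' (h x) = 1"
    and subtrees: "\<And>x y. x \<in> verts P \<Longrightarrow> x \<notin> range S.cyc \<Longrightarrow> height P' (g x) = 1
      \<Longrightarrow> y \<in> verts (subtree P x) \<Longrightarrow> g y = h y"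
  shows "g = h"
proof (rule PiE_ext)
  show "g \<in> verts P \<rightarrow>\<^sub>E verts P'" "h \<in> verts P \<rightarrow>\<^sub>E verts P'"
    using g h by (auto simp: Hom_at_def digraph_Hom_iff)
  fix v assume v: "v \<in> verts P"
  show "g v = h v"
  proof (cases "height P' (g v) = 0 \<and> height P' (h v) = 0")
    case True
    then show ?thesis
      using Hom_root[OF g v] Hom_root[OF h v] by (simp add: T.root_def)
  next
    case False
    then obtain x where "x \<in> verts P" "x \<notin> range S.cyc" "height P' (g x) = 1"
      "v \<in> verts (subtree P x)"
      using positive_height_in_subtree[OF g v] positive_height_in_subtree[OF h v] heights
      by (metis gr0I)
    then show ?thesis by (rule subtrees)
  qed
qed

text \<open>
  The glued map follows \<open>\<psi> x\<close> on the subtree above \<open>x\<close>, and collapses all other vertices onto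
  the cycle according to their offsets. An arc can only leave such a subtree at its root \<open>x\<close>, and
  there \<open>\<psi> x x\<close> has height one above \<open>target k x\<close>, the value of the collapse at the successor of
  \<open>x\<close>. No arc enters a subtree from outside.
\<close>

lemma ex_Hom_gluing:
  assumes U: "U \<subseteq> verts P - range S.cyc"
    and antichain: "\<And>x y n. x \<in> U \<Longrightarrow> y \<in> U \<Longrightarrow> (S.succ ^^ n) y = x \<Longrightarrow> x = y"
    and \<psi>: "\<And>x. x \<in> U \<Longrightarrow> \<psi> x \<in> forest_Hom (subtree P x) (T.truncated (target k x))"
  shows "\<exists>g \<in> Hom_at P P' (z 0) (T.cyc k).
    (\<forall>x \<in> U. restrict g (verts (subtree P x)) = \<psi> x) \<and>
    (\<forall>x \<in> verts P - range S.cyc. height P' (g x) = 1 \<longleftrightarrow> x \<in> U)"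
proof -
  \<comment> \<open>Two members of \<open>U\<close> on one forward path are comparable, so the subtrees above \<open>U\<close> are disjoint.\<close>
  have unique: "x = x'" if x: "x \<in> U" "x' \<in> U" "y \<in> verts (subtree P x)" "y \<in> verts (subtree P x')"
    for x x' y
  proof -
    from x obtain a b where "(S.succ ^^ a) y = x" "(S.succ ^^ b) y = x'"
      by (auto simp: S.verts_subtree)
    moreover from this have "(S.succ ^^ (b - a)) x = x' \<or> (S.succ ^^ (a - b)) x' = x"
      by (cases "a \<le> b") (auto simp: funpow_funpow)
    ultimately show ?thesis
      using antichain x(1,2) by metis
  qed
  have \<psi>': "\<psi> x \<in> verts (subtree P x) \<rightarrow>\<^sub>E verts (T.truncated (target k x))" "height P' (\<psi> x x) = 1"
    "\<And>y. y \<in> verts (subtree P x) \<Longrightarrow> y \<noteq> x \<Longrightarrow> \<psi> x (S.succ y) = T.succ (\<psi> x y)"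
    if "x \<in> U" for x
    using \<psi>[OF that] that U by (auto simp: forest_Hom_subtree_iff subset_iff)
  define g where "g y = (if y \<notin> verts P then undefined
      else if \<exists>x \<in> U. y \<in> verts (subtree P x)
      then \<psi> (SOME x. x \<in> U \<and> y \<in> verts (subtree P x)) y else T.cyc (S.offset y + k))" for y
  have g_in: "g y = \<psi> x y" if "x \<in> U" "y \<in> verts (subtree P x)" for x y
  proof -
    have "(SOME x. x \<in> U \<and> y \<in> verts (subtree P x)) = x"
      using that unique by blast
    moreover have "y \<in> verts P"
      using that by (simp add: S.verts_subtree)
    ultimately show ?thesis
      using that by (auto simp: g_def)
  qed
  have g_out: "g y = T.cyc (S.offset y + k)"
    if "y \<in> verts P" "\<And>x. x \<in> U \<Longrightarrow> y \<notin> verts (subtree P x)" for y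
    using that by (auto simp: g_def)
  have out_cyc: "S.cyc j \<notin> verts (subtree P x)" if "x \<in> U" for j x
    using that U by (auto simp: S.verts_subtree S.funpow_cyc)
  have step: "g (S.succ y) = T.succ (g y)" if y: "y \<in> verts P" for y
  proof (cases "\<exists>x \<in> U. y \<in> verts (subtree P x)")
    case True
    then obtain x where x: "x \<in> U" "y \<in> verts (subtree P x)" by blast
    show ?thesis
    proof (cases "y = x")
      case False
      then show ?thesis
        using x S.succ_in_subtree[OF x(2)] g_in \<psi>'(3)[OF x(1)] by simp
    next
      case True
      \<comment> \<open>Leaving the subtree at its root: below \<open>x\<close> there is no further member of the antichain.\<close>
      have "S.succ x \<notin> verts (subtree P x')" if "x' \<in> U" for x'
      proof
        assume *: "S.succ x \<in> verts (subtree P x')"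
        then obtain n where "(S.succ ^^ n) (S.succ x) = x'"
          by (auto simp: S.verts_subtree)
        then have "(S.succ ^^ Suc n) x = x'"
          by (simp add: funpow_swap1)
        with antichain[OF that x(1)] have "x' = x" by blast
        with * show False
          using S.succ_notin_subtree[of x] U x(1) by auto
      qed
      then have "g (S.succ y) = T.cyc (S.offset (S.succ x) + k)"
        using True g_out[of "S.succ x"] y by simp
      also have "\<dots> = target k x"
        using T_cyc_eq[OF S.offset_succ, of x k] y True by (simp add: target_def algebra_simps)
      also have "\<dots> = T.root (\<psi> x x)"
        using PiE_mem[OF \<psi>'(1)[OF x(1)] x(2)] True by (simp add: T.verts_truncated)
      also have "\<dots> = T.succ (g y)"
        using \<psi>'(2)[OF x(1)] g_in[OF x] True by (simp add: T.root_def)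
      finally show ?thesis .
    qed
  next
    case False
    have "S.succ y \<notin> verts (subtree P x)" if "x \<in> U" for x
    proof
      assume "S.succ y \<in> verts (subtree P x)"
      then obtain n where "(S.succ ^^ Suc n) y = x"
        by (auto simp: S.verts_subtree funpow_swap1)
      then have "y \<in> verts (subtree P x)"
        using y unfolding S.verts_subtree by blast
      with False that show False by blast
    qed
    then have "g (S.succ y) = T.cyc (S.offset (S.succ y) + k)"
      using g_out[of "S.succ y"] y by simp
    also have "\<dots> = T.cyc (S.offset y + k + 1)"
      using T_cyc_eq[OF S.offset_succ[OF y], of k] by (simp add: algebra_simps)
    also have "\<dots> = T.succ (g y)"
      using g_out[OF y] False by (auto simp: T.succ_cyc)
    finally show ?thesis .
  qed
  have g_verts: "g y \<in> verts P'" if "y \<in> verts P" for y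
  proof (cases "\<exists>x \<in> U. y \<in> verts (subtree P x)")
    case True
    then obtain x where x: "x \<in> U" "y \<in> verts (subtree P x)" by blast
    then have "\<psi> x y \<in> verts (T.truncated (target k x))"
      using \<psi>'(1) by blast
    then show ?thesis
      using g_in[OF x] by (simp add: T.verts_truncated)
  next
    case False
    then show ?thesis using g_out[OF that] by auto
  qed
  have Hom: "g \<in> digraph_Hom P P'"
    using step g_verts by (auto simp: digraph_Hom_iff g_def)
  \<comment> \<open>The vertex \<open>z 0\<close> lies in no subtree, so the collapse decides its image.\<close>
  have "g (S.cyc 0) = T.cyc (S.offset (S.cyc 0) + k)"
    using g_out[of "S.cyc 0"] out_cyc by simp
  also have "\<dots> = T.cyc k"
    using T_cyc_eq[OF S.offset_cyc, of 0 k] by simp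
  finally have "g \<in> Hom_at P P' (z 0) (T.cyc k)"
    using Hom S.cyc_z[OF S.m_pos] by (simp add: Hom_at_def)
  moreover have "restrict g (verts (subtree P x)) = \<psi> x" if "x \<in> U" for x
    using \<psi>'(1)[OF that] g_in[OF that] by (auto simp: fun_eq_iff restrict_def PiE_def extensional_def)
  moreover have "height P' (g x) = 1 \<longleftrightarrow> x \<in> U" if x: "x \<in> verts P" "x \<notin> range S.cyc" for x
  proof
    assume "x \<in> U"
    then show "height P' (g x) = 1"
      using \<psi>'(2) g_in[of x x] S.self_in_subtree[OF x(1)] by simp
  next
    assume *: "height P' (g x) = 1"
    have "\<exists>x' \<in> U. x \<in> verts (subtree P x')"
    proof (rule ccontr)
      assume "\<not> ?thesis"
      then have "g x = T.cyc (S.offset x + k)"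
        using g_out[OF x(1)] by blast
      with * show False by simp
    qed
    then obtain x' n where x': "x' \<in> U" "(S.succ ^^ n) x = x'"
      by (auto simp: S.verts_subtree)
    then have "x' \<in> verts P" using U by auto
    then have "height P' (g x') = 1"
      using \<psi>'(2) g_in[of x' x'] S.self_in_subtree x' by simp
    then have "height P' (g x) - n = 1"
      using Hom_funpow[OF Hom x(1), of n] x' T.height_funpow[of "g x" n] g_verts[OF x(1)] by simp
    then have "n = 0" using * by simp
    then show "x \<in> U" using x' by simp
  qed
  ultimately show ?thesis by blast
qed



section \<open>Sequences of incomparable vertex subsets\<close>

lemma Inc_seqs_memD:
  assumes "A \<in> Inc_seqs P m z" "i < m" "x \<in> A i"
  shows "x \<in> verts P" "S.root x = z i" "x \<notin> range S.cyc"
proof -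
  have "A i \<in> Inc (cycle_tree P (z i)) (z i)"
    using assms(1,2) by (auto simp: Inc_seqs_def)
  then have "x \<in> verts P" "S.root x = z i" "x \<noteq> z i"
    using assms(3) by (auto simp: S.Inc_cycle_tree_iff)
  then show "x \<in> verts P" "S.root x = z i" "x \<notin> range S.cyc"
    using S.root_eq_self_iff[of x] by auto
qed

text \<open>
  Comparable vertices off the cycle have the same root, so the union of the sets \<open>A i\<close>, each an
  antichain in its own tree, is an antichain in the whole digraph.
\<close>

lemma Inc_seqs_antichain:
  assumes "A \<in> Inc_seqs P m z" "i < m" "j < m" "x \<in> A i" "y \<in> A j" "(S.succ ^^ n) y = x"
  shows "x = y"
proof -
  note x = Inc_seqs_memD[OF assms(1,2,4)] and y = Inc_seqs_memD[OF assms(1,3,5)]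
  have "n \<le> height P y"
    using S.funpow_in_cycle_iff[OF y(1), of n] assms(6) x(3) by auto
  then have "z i = z j"
    using S.root_funpow[OF y(1), of n] assms(6) x(2) y(2) by simp
  then have "i = j"
    using inj_onD[OF S.inj_z] assms(2,3) by simp
  moreover have "A i \<in> Inc (cycle_tree P (z i)) (z i)"
    using assms(1,2) by (auto simp: Inc_seqs_def)
  ultimately show ?thesis
    using assms(4-6) by (auto simp: S.Inc_cycle_tree_iff)
qed

lemma level_eq:
  assumes "A \<in> Inc_seqs P m z" "i < m"
  shows "level P z A i h = {x \<in> A i. height P x = h}"
  using S.tree_dist_cycle_tree Inc_seqs_memD[OF assms] by (fastforce simp: level_def)

text \<open>
  For \<open>x\<close> at distance \<open>h\<close> from \<open>z i\<close> the offset is \<open>i - h\<close> modulo \<open>m\<close>.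
\<close>

lemma truncated_tree_eq:
  assumes "A \<in> Inc_seqs P m z" "i < m" "x \<in> level P z A i h"
  shows "truncated_tree P' l z' i k h = T.truncated (target (int k) x)"
proof -
  have x: "x \<in> A i" "height P x = h"
    using assms by (auto simp: level_eq)
  note x' = Inc_seqs_memD[OF assms(1,2) x(1)]
  have "S.cyc (int i) = S.cyc (S.offset x + int h)"
    using x x' S.root_offset[of x] S.cyc_z[OF assms(2)] by simp
  then have "[int i = S.offset x + int h] (mod int m)"
    by (simp add: S.cyc_eq_iff)
  from T_cyc_eq[OF this, of "int k - int h + 1"]
  have "T.cyc (int i + int k - int h + 1) = target (int k) x"
    by (simp add: target_def algebra_simps)
  then show ?thesis
    by (simp add: truncated_tree_def T.truncated_def Let_def T.cyc_def)
qed

text \<open>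
  If \<open>x\<close> is \<open>n\<close> steps below \<open>y\<close> and both images have height one, then \<open>n = 0\<close>, because heights
  off the cycle drop with each step.
\<close>

lemma inc_seq_in_Inc_seqs:
  assumes g: "g \<in> digraph_Hom P P'"
  shows "inc_seq P m z P' g \<in> Inc_seqs P m z"
proof -
  have "x = y" if "y \<in> verts P" "height P' (g x) = 1" "height P' (g y) = 1" "(S.succ ^^ n) y = x"
    for x y n
  proof -
    have "height P' (g x) = height P' (g y) - n"
      using that Hom_funpow[OF g, of y n] T.height_funpow[of "g y" n] g by simp
    then have "n = 0" using that by simp
    then show ?thesis using that by simp
  qed
  then show ?thesis
    by (auto simp: Inc_seqs_def inc_seq_def S.Inc_cycle_tree_iff S.verts_cycle_tree)
qed

text \<open>
  A vertex determines through its root the index \<open>i\<close> of the set to which it can belong, so a sequence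
  of incomparable subsets carries the same information as its union.
\<close>

lemma inc_seq_eq_iff:
  assumes A: "A \<in> Inc_seqs P m z"
  shows "inc_seq P m z P' g = A \<longleftrightarrow>
    (\<forall>x \<in> verts P - range S.cyc. height P' (g x) = 1 \<longleftrightarrow> x \<in> (\<Union>i<m. A i))" (is "?L \<longleftrightarrow> ?R")
proof
  assume ?L
  then have A_eq: "A i = {x \<in> verts P. S.root x = z i \<and> x \<noteq> z i \<and> height P' (g x) = 1}"
    if "i < m" for i
    using that by (auto simp: inc_seq_def S.verts_cycle_tree)
  show ?R
  proof
    fix x assume x: "x \<in> verts P - range S.cyc"
    then have "S.root x \<in> z ` {..<m}"
      using S.root_in_cycle[of x] S.range_cyc by simp
    then obtain i where i: "i < m" "S.root x = z i" by auto
    moreover have "x \<noteq> z i"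
      using x S.range_cyc i(1) by auto
    ultimately show "height P' (g x) = 1 \<longleftrightarrow> x \<in> (\<Union>i<m. A i)"
      using x A_eq by auto
  qed
next
  assume R: ?R
  show ?L
  proof (rule PiE_ext)
    show "A \<in> (\<Pi>\<^sub>E i \<in> {..<m}. UNIV)" "inc_seq P m z P' g \<in> (\<Pi>\<^sub>E i \<in> {..<m}. UNIV)"
      using A by (auto simp: Inc_seqs_def inc_seq_def PiE_def)
    fix i assume "i \<in> {..<m}"
    then have i: "i < m" by simp
    have "x \<in> inc_seq P m z P' g i \<longleftrightarrow> x \<in> A i" for x
    proof
      assume "x \<in> inc_seq P m z P' g i"
      then have x: "x \<in> verts P" "S.root x = z i" "x \<noteq> z i" "height P' (g x) = 1"
        using i by (auto simp: inc_seq_def S.verts_cycle_tree)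
      then have "x \<in> verts P - range S.cyc"
        using S.root_eq_self_iff[of x] by auto
      then obtain j where j: "j < m" "x \<in> A j"
        using R x(4) by blast
      then have "j = i"
        using Inc_seqs_memD(2)[OF A j] x(2) inj_onD[OF S.inj_z, of i j] i by simp
      then show "x \<in> A i" using j by simp
    next
      assume x: "x \<in> A i"
      note x' = Inc_seqs_memD[OF A i x]
      have "x \<noteq> z i"
        using x'(3) S.range_cyc i by auto
      moreover have "height P' (g x) = 1"
        using R x x' i by blast
      ultimately show "x \<in> inc_seq P m z P' g i"
        using x' i by (auto simp: inc_seq_def S.verts_cycle_tree)
    qed
    then show "inc_seq P m z P' g i = A i" by blast
  qed
qed


section \<open>The bijection and the counting formula\<close>

lemma restriction_family_apply:
  assumes "A \<in> Inc_seqs P m z" "i < m" "x \<in> A i"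
  shows "restriction_family P m z A g i (height P x) x = restrict g (verts (subtree P x))"
proof -
  have "height P x \<noteq> 0"
    using Inc_seqs_memD[OF assms] S.height_0_iff by auto
  then show ?thesis
    using assms by (simp add: restriction_family_def level_eq)
qed

text \<open>
  Restriction lands in the product by \<open>restrict_Hom_in_forest_Hom\<close>, is injective by
  \<open>Hom_at_eqI\<close>, and is surjective by \<open>ex_Hom_gluing\<close>, applied to the union of the \<open>A i\<close>.
\<close>

lemma bij_betw_restriction_family:
  assumes A: "A \<in> Inc_seqs P m z" and k: "k < l"
  shows "bij_betw (restriction_family P m z A)
         (Hom_at_inc P m z P' (z' k) A)
         (\<Pi>\<^sub>E i \<in> {..<m}. \<Pi>\<^sub>E h \<in> {1..}. \<Pi>\<^sub>E x \<in> level P z A i h.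
            forest_Hom (subtree P x) (truncated_tree P' l z' i k h))" (is "bij_betw ?r ?H ?Pi")
proof -
  define U where "U = (\<Union>i<m. A i)"
  have U: "U \<subseteq> verts P - range S.cyc"
    using Inc_seqs_memD(1,3)[OF A] unfolding U_def by blast
  have H_iff: "g \<in> ?H \<longleftrightarrow> g \<in> Hom_at P P' (z 0) (T.cyc (int k))
      \<and> (\<forall>x \<in> verts P - range S.cyc. height P' (g x) = 1 \<longleftrightarrow> x \<in> U)" for g
    using inc_seq_eq_iff[OF A] T.cyc_z[OF k] by (simp add: Hom_at_inc_def U_def)
  have r_in: "?r g \<in> ?Pi" if g: "g \<in> ?H" for g
    unfolding restriction_family_def
  proof (intro restrict_PiE_iff[THEN iffD2] ballI)
    fix i h x assume i: "i \<in> {..<m}" and x: "x \<in> level P z A i h"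
    then have "x \<in> A i" "i < m"
      using level_eq[OF A] by auto
    then have "x \<in> U" by (auto simp: U_def)
    then show "restrict g (verts (subtree P x))
        \<in> forest_Hom (subtree P x) (truncated_tree P' l z' i k h)"
      using g U truncated_tree_eq[OF A \<open>i < m\<close> x] by (auto simp: H_iff intro!: restrict_Hom_in_forest_Hom)
  qed
  have inj: "g = g'" if g: "g \<in> ?H" and g': "g' \<in> ?H" and eq: "?r g = ?r g'" for g g'
  proof (rule Hom_at_eqI)
    show "g \<in> Hom_at P P' (z 0) (T.cyc (int k))" "g' \<in> Hom_at P P' (z 0) (T.cyc (int k))"
      using g g' by (auto simp: H_iff)
    show "height P' (g x) = 1 \<longleftrightarrow> height P' (g' x) = 1" if "x \<in> verts P" "x \<notin> range S.cyc" for x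
      using g g' that by (simp add: H_iff)
    show "g y = g' y" if x: "x \<in> verts P" "x \<notin> range S.cyc" "height P' (g x) = 1"
      and y: "y \<in> verts (subtree P x)" for x y
    proof -
      have "x \<in> U" using g x by (simp add: H_iff)
      then obtain i where "i < m" "x \<in> A i" by (auto simp: U_def)
      from restriction_family_apply[OF A this]
      have "restrict g (verts (subtree P x)) = restrict g' (verts (subtree P x))"
        using eq by metis
      then show ?thesis using y by (metis restrict_apply')
    qed
  qed
  have surj: "\<exists>g \<in> ?H. ?r g = \<phi>" if \<phi>: "\<phi> \<in> ?Pi" for \<phi>
  proof -
    \<comment> \<open>The indices \<open>i\<close> and \<open>h\<close> of \<open>\<phi>\<close> can be recovered from \<open>x\<close>, which flattens the triple product.\<close>
    define \<psi> where "\<psi> x = \<phi> (SOME i. i < m \<and> x \<in> A i) (height P x) x" for x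
    have \<psi>_eq: "\<psi> x = \<phi> i (height P x) x" if "i < m" "x \<in> A i" for i x
    proof -
      have "j = i" if "j < m" "x \<in> A j" for j
        using Inc_seqs_memD(2)[OF A that] Inc_seqs_memD(2)[OF A \<open>i < m\<close> \<open>x \<in> A i\<close>]
          that(1) \<open>i < m\<close> inj_onD[OF S.inj_z, of i j] by simp
      then have "(SOME i. i < m \<and> x \<in> A i) = i"
        using that by blast
      then show ?thesis by (simp add: \<psi>_def)
    qed
    have \<psi>: "\<psi> x \<in> forest_Hom (subtree P x) (T.truncated (target (int k) x))" if "x \<in> U" for x
    proof -
      obtain i where i: "i < m" "x \<in> A i" using \<open>x \<in> U\<close> by (auto simp: U_def)
      have "height P x \<noteq> 0"
        using Inc_seqs_memD[OF A i] S.height_0_iff by auto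
      then have h: "height P x \<in> {1..}" by simp
      have x: "x \<in> level P z A i (height P x)"
        using i level_eq[OF A] by simp
      have "\<phi> i \<in> (\<Pi>\<^sub>E h \<in> {1..}. \<Pi>\<^sub>E x \<in> level P z A i h.
          forest_Hom (subtree P x) (truncated_tree P' l z' i k h))"
        using PiE_mem[OF \<phi>, of i] i by simp
      from PiE_mem[OF PiE_mem[OF this h] x] show ?thesis
        using truncated_tree_eq[OF A i(1) x] \<psi>_eq[OF i] by simp
    qed
    have "\<exists>g \<in> Hom_at P P' (z 0) (T.cyc (int k)).
        (\<forall>x \<in> U. restrict g (verts (subtree P x)) = \<psi> x) \<and>
        (\<forall>x \<in> verts P - range S.cyc. height P' (g x) = 1 \<longleftrightarrow> x \<in> U)"
    proof (rule ex_Hom_gluing[OF U])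
      fix x y n assume "x \<in> U" "y \<in> U" "(S.succ ^^ n) y = x"
      then show "x = y"
        using Inc_seqs_antichain[OF A] by (auto simp: U_def)
    qed (rule \<psi>)
    then obtain g where g: "g \<in> Hom_at P P' (z 0) (T.cyc (int k))"
      "\<And>x. x \<in> U \<Longrightarrow> restrict g (verts (subtree P x)) = \<psi> x"
      "\<And>x. x \<in> verts P \<Longrightarrow> x \<notin> range S.cyc \<Longrightarrow> height P' (g x) = 1 \<longleftrightarrow> x \<in> U"
      by auto
    have gH: "g \<in> ?H"
      using g by (simp add: H_iff)
    have "?r g = \<phi>"
    proof (rule PiE_ext[OF r_in[OF gH] \<phi>])
      fix i assume i: "i \<in> {..<m}"
      show "?r g i = \<phi> i"
      proof (rule PiE_ext[OF PiE_mem[OF r_in[OF gH] i] PiE_mem[OF \<phi> i]])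
        fix h :: nat assume h: "h \<in> {1..}"
        show "?r g i h = \<phi> i h"
        proof (rule PiE_ext[OF PiE_mem[OF PiE_mem[OF r_in[OF gH] i] h] PiE_mem[OF PiE_mem[OF \<phi> i] h]])
          fix x assume "x \<in> level P z A i h"
          then have x: "i < m" "x \<in> A i" "height P x = h" "x \<in> U"
            using i level_eq[OF A] by (auto simp: U_def)
          then show "?r g i h x = \<phi> i h x"
            using restriction_family_apply[OF A x(1,2), of g] g(2)[OF x(4)] \<psi>_eq[OF x(1,2)] by simp
        qed
      qed
    qed
    with gH show ?thesis by blast
  qed
  show ?thesis
  proof (rule bij_betwI')
    fix g g' assume "g \<in> ?H" "g' \<in> ?H"
    then show "?r g = ?r g' \<longleftrightarrow> g = g'"
      using inj[of g g'] by (intro iffI) simp_all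
  next
    fix \<phi> assume "\<phi> \<in> ?Pi"
    from surj[OF this] obtain g where "g \<in> ?H" "?r g = \<phi>" ..
    then show "\<exists>g \<in> ?H. \<phi> = ?r g"
      by (intro bexI[of _ g]) simp_all
  qed (rule r_in)
qed

lemma Hom_decomposition:
  shows "digraph_Hom P P' = (\<Union>k<l. Hom_at P P' (z 0) (z' k))"
    and "disjoint_family_on (\<lambda>k. Hom_at P P' (z 0) (z' k)) {..<l}"
proof -
  show "digraph_Hom P P' = (\<Union>k<l. Hom_at P P' (z 0) (z' k))"
    using Hom_z0_in_cycle T.cyc_z by (fastforce simp: Hom_at_def)
  show "disjoint_family_on (\<lambda>k. Hom_at P P' (z 0) (z' k)) {..<l}"
    using inj_onD[OF T.inj_z] by (auto simp: disjoint_family_on_def Hom_at_def)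
qed

lemma Hom_at_decomposition:
  shows "Hom_at P P' (z 0) w = (\<Union>A \<in> Inc_seqs P m z. Hom_at_inc P m z P' w A)"
    and "disjoint_family_on (\<lambda>A. Hom_at_inc P m z P' w A) (Inc_seqs P m z)"
  using inc_seq_in_Inc_seqs by (auto simp: Hom_at_inc_def Hom_at_def disjoint_family_on_def)

lemma card_Hom_at_inc:
  assumes fin: "finite (verts P)" and A: "A \<in> Inc_seqs P m z" and k: "k < l"
  shows "card (Hom_at_inc P m z P' (z' k) A) =
    (\<Prod>i<m. \<Prod>h | 1 \<le> h \<and> level P z A i h \<noteq> {}. \<Prod>x \<in> level P z A i h.
       card (forest_Hom (subtree P x) (truncated_tree P' l z' i k h)))"
proof -
  have finite_A: "finite (A i)" if "i < m" for i
    using Inc_seqs_memD(1)[OF A that] by (intro finite_subset[OF _ fin]) auto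
  have "card (\<Pi>\<^sub>E h \<in> {1..}. \<Pi>\<^sub>E x \<in> level P z A i h.
          forest_Hom (subtree P x) (truncated_tree P' l z' i k h))
      = (\<Prod>h | 1 \<le> h \<and> level P z A i h \<noteq> {}. \<Prod>x \<in> level P z A i h.
          card (forest_Hom (subtree P x) (truncated_tree P' l z' i k h)))" if i: "i < m" for i
  proof (subst card_PiE_singletons[where J = "{h. 1 \<le> h \<and> level P z A i h \<noteq> {}}"])
    have "{h. 1 \<le> h \<and> level P z A i h \<noteq> {}} \<subseteq> height P ` A i"
      using level_eq[OF A i] by auto
    then show "finite {h. 1 \<le> h \<and> level P z A i h \<noteq> {}}"
      using finite_A[OF i] finite_subset by blast
    show "(\<Prod>h | 1 \<le> h \<and> level P z A i h \<noteq> {}. card (\<Pi>\<^sub>E x \<in> level P z A i h.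
          forest_Hom (subtree P x) (truncated_tree P' l z' i k h)))
      = (\<Prod>h | 1 \<le> h \<and> level P z A i h \<noteq> {}. \<Prod>x \<in> level P z A i h.
          card (forest_Hom (subtree P x) (truncated_tree P' l z' i k h)))"
      using finite_A[OF i] level_eq[OF A i] by (intro prod.cong refl card_PiE) simp
  qed auto
  then show ?thesis
    using bij_betw_same_card[OF bij_betw_restriction_family[OF A k]] by (simp add: card_PiE)
qed

end

theorem theorem2p32:
  fixes P :: "('a,'b) pre_digraph" and P' :: "('c,'d) pre_digraph"
    and m l :: nat and z :: "nat \<Rightarrow> 'a" and z' :: "nat \<Rightarrow> 'c"
  assumes "finite (verts P)" and "pseudocycle P" and "directed_cycle P m z"
    and "finite (verts P')" and "pseudocycle P'" and "directed_cycle P' l z'"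
    and "l dvd m"
  shows
    "(digraph_Hom P P' = (\<Union>k<l. Hom_at P P' (z 0) (z' k))
       \<and> disjoint_family_on (\<lambda>k. Hom_at P P' (z 0) (z' k)) {..<l})
   \<and> (\<forall>k<l. Hom_at P P' (z 0) (z' k) = (\<Union>A \<in> Inc_seqs P m z. Hom_at_inc P m z P' (z' k) A)
       \<and> disjoint_family_on (\<lambda>A. Hom_at_inc P m z P' (z' k) A) (Inc_seqs P m z))
   \<and> (\<forall>k<l. \<forall>A \<in> Inc_seqs P m z.
       bij_betw (restriction_family P m z A)
         (Hom_at_inc P m z P' (z' k) A)
         (\<Pi>\<^sub>E i \<in> {..<m}. \<Pi>\<^sub>E h \<in> {1..}. \<Pi>\<^sub>E x \<in> level P z A i h.
            forest_Hom (subtree P x) (truncated_tree P' l z' i k h)))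
   \<and> (card (digraph_Hom P P') = (\<Sum>k<l. card (Hom_at P P' (z 0) (z' k)))
     \<and> (\<Sum>k<l. card (Hom_at P P' (z 0) (z' k)))
         = (\<Sum>k<l. \<Sum>A \<in> Inc_seqs P m z. card (Hom_at_inc P m z P' (z' k) A))
     \<and> (\<Sum>k<l. \<Sum>A \<in> Inc_seqs P m z. card (Hom_at_inc P m z P' (z' k) A))
         = (\<Sum>k<l. \<Sum>A \<in> Inc_seqs P m z.
              \<Prod>i<m. \<Prod>h | 1 \<le> h \<and> level P z A i h \<noteq> {}. \<Prod>x \<in> level P z A i h.
                card (forest_Hom (subtree P x) (truncated_tree P' l z' i k h))))"
proof -
  interpret pseudocycle_pair P m z P' l z'
    using assms by unfold_locales
  have "finite (verts P \<rightarrow>\<^sub>E verts P')"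
    using assms(1,4) by (simp add: finite_PiE)
  then have finite_Hom: "finite (digraph_Hom P P')"
    by (simp add: digraph_Hom_def)
  then have finite_Hom_at: "finite (Hom_at P P' (z 0) w)" for w
    by (simp add: Hom_at_def)
  then have finite_Hom_at_inc: "finite (Hom_at_inc P m z P' w A)" for w A
    by (simp add: Hom_at_inc_def)
  have "finite (Inc (cycle_tree P c) c)" for c
  proof (rule finite_subset)
    show "Inc (cycle_tree P c) c \<subseteq> Pow (verts P)"
      unfolding Inc_def S.verts_cycle_tree by blast
    show "finite (Pow (verts P))"
      using assms(1) by simp
  qed
  then have finite_Inc_seqs: "finite (Inc_seqs P m z)"
    by (simp add: Inc_seqs_def finite_PiE)
  have "card (digraph_Hom P P') = (\<Sum>k<l. card (Hom_at P P' (z 0) (z' k)))"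
    unfolding Hom_decomposition(1)
    by (rule card_UN_disjoint'[OF Hom_decomposition(2) finite_Hom_at]) simp
  moreover have "card (Hom_at P P' (z 0) w)
      = (\<Sum>A \<in> Inc_seqs P m z. card (Hom_at_inc P m z P' w A))" for w
    unfolding Hom_at_decomposition(1)
    by (rule card_UN_disjoint'[OF Hom_at_decomposition(2) finite_Hom_at_inc finite_Inc_seqs])
  ultimately show ?thesis
    using Hom_decomposition Hom_at_decomposition bij_betw_restriction_family
      card_Hom_at_inc[OF assms(1)] by simp
qed

end
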